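(* Let $\mathcal{X},\mathcal{Y}$ be finite sets, $m=|\mathcal{Y}|$, let $s=\{(x^{(i)},y^{(i)})\}_{i=1}^n\subseteq\mathcal{X}\times\mathcal{Y}$ be a dataset with empirical distribution $\hat q$, let $f_\theta:\mathcal{X}\to\mathbb{R}^m$ be a model differentiable in its parameter $\theta\in\mathbb{R}^p$, and let $\Phi$ be a closed proper strictly convex function on $\mathbb{R}^m$ with $\mathbf{1}_y\in\mathrm{dom}(\Phi)$ for all $y\in\mathcal{Y}$ and with conjugate $\Phi^*$ finite and differentiable on $\mathbb{R}^m$. Let $\psi$ be an $L_2$-norm power function such that for each $y$ the function $\nu\mapsto d_\Phi(\mathbf{1}_y,\nu)$ on $\mathbb{R}^m$ is $\mathcal{H}(\psi)$-convex. Put $g(x,y)=\nabla_\theta d_\Phi(\mathbf{1}_y,f_\theta(x))$ and $f_\theta(x)_{\Phi^*}^*=\nabla\Phi^*(f_\theta(x))$. If $\lambda_{\min}(A_s)\ne0$, then: 1. (Individual sample bound) for every $(x,y)\in s$, $$\frac{\|g(x,y)\|_2^2}{\lambda_{\max}(A_x)}\le\|\mathbf{1}_y-f_\theta(x)_{\Phi^*}^*\|_2^2\le\frac{\|g(x,y)\|_2^2}{\lambda_{\min}(A_x)}.$$ 2. (Dataset bound) $$\mathcal{L}_{L_2^2/2}(\hat q,f_\theta(\cdot)_{\Phi^*}^* )\le\mathbb{E}_{(X,Y)\sim\hat q}\left[\frac{\|g(X,Y)\|_2^2}{2\lambda_{\min}(A_X)}\right],\qquad \mathcal{L}_\Phi(\hat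 q,f_\theta(\cdot))\le\frac{\mathbb{E}_{(X,Y)\sim\hat q}\,\psi^*(g(X,Y))}{\lambda_{\min}(A_s)^{r_{\psi^*}/2}}.$$
   Context: $\mathbf{1}_y\in\mathbb{R}^m$ is the one-hot vector of label $y$. $\Phi^*(\nu)=\sup_\mu\{\langle\mu,\nu\rangle-\Phi(\mu)\}$ and $d_\Phi(\mu,\nu)=\Phi(\mu)+\Phi^*(\nu)-\langle\mu,\nu\rangle$ is the Fenchel-Young loss. $\nabla_\theta f_\theta(x)$ is the $p\times m$ matrix whose $j$-th column is the gradient of the $j$-th output; the structure matrix is the $m\times m$ matrix $A_x=\nabla_\theta f_\theta(x)^\top\nabla_\theta f_\theta(x)$, with extreme eigenvalues $\lambda_{\min}(A_x),\lambda_{\max}(A_x)$, and $\lambda_{\min}(A_s):=\min_{(x,y)\in s}\lambda_{\min}(A_x)$. Risks: $\mathcal{L}_\Phi(\hat q,f_\theta(\cdot))=\mathbb{E}_{(X,Y)\sim\hat q}\,d_\Phi(\mathbf{1}_Y,f_\theta(X))$ and $\mathcal{L}_{L_2^2/2}(\hat q,h(\cdot))=\mathbb{E}_{(X,Y)\sim\hat q}\,\tfrac12\|\mathbf{1}_Y-h(X)\|_2^2$. An $L_2$-norm power function is $\psi(\mu)=\|a_\psi\mu\|_2^{r_\psi}/r_\psi$ with $a_\psi>0,r_\psi>1$; its conjugate is $\psi^*(\nu)=\|\nu/a_\psi\|_2^{r_{\psi^*}}/r_{\psi^*}$ with $1/r_\psi+1/r_{\psi^*}=1$, and the same formula is used for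 vectors of any dimension (in particular $g(x,y)\in\mathbb{R}^p$). A differentiable $F$ is $\mathcal{H}(\psi)$-convex if $F(\mu)-F(\nu)-\langle\nabla F(\nu),\mu-\nu\rangle\ge\psi(\mu-\nu)$ for all $\mu,\nu$ in its domain. *)

theory Defs
  imports "HOL-Probability.Probability"
begin

text \<open>Convex functions on the whole space take values in the extended reals; the effective
  domain is the set where the value is below \<open>\<infinity>\<close>.\<close>

definition eff_dom :: "('a \<Rightarrow> ereal) \<Rightarrow> 'a set" where
  "eff_dom \<Phi> = {x. \<Phi> x < \<infinity>}"

definition proper_fun :: "('a \<Rightarrow> ereal) \<Rightarrow> bool" where
  "proper_fun \<Phi> \<longleftrightarrow> (\<forall>x. \<Phi> x \<noteq> -\<infinity>) \<and> eff_dom \<Phi> \<noteq> {}"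

definition closed_fun :: "('a::topological_space \<Rightarrow> ereal) \<Rightarrow> bool" where
  "closed_fun \<Phi> \<longleftrightarrow> closed {(x, t::real). \<Phi> x \<le> ereal t}"

text \<open>For proper functions the values on the effective domain are finite, so no
  \<open>\<infinity> - \<infinity>\<close> arises below, and convexity on the whole space follows.\<close>

definition strictly_convex_fun :: "('a::real_vector \<Rightarrow> ereal) \<Rightarrow> bool" where
  "strictly_convex_fun \<Phi> \<longleftrightarrow>
     (\<forall>x\<in>eff_dom \<Phi>. \<forall>y\<in>eff_dom \<Phi>. \<forall>t. x \<noteq> y \<longrightarrow> 0 < t \<longrightarrow> t < 1 \<longrightarrow>
        \<Phi> ((1 - t) *\<^sub>R x + t *\<^sub>R y) < ereal (1 - t) * \<Phi> x + ereal t * \<Phi> y)"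

definition fenchel_conj :: "('a::real_inner \<Rightarrow> ereal) \<Rightarrow> 'a \<Rightarrow> ereal" where
  "fenchel_conj \<Phi> \<nu> = (SUP \<mu>. ereal (\<mu> \<bullet> \<nu>) - \<Phi> \<mu>)"

definition fy_loss :: "('a::real_inner \<Rightarrow> ereal) \<Rightarrow> 'a \<Rightarrow> 'a \<Rightarrow> ereal" where
  "fy_loss \<Phi> \<mu> \<nu> = \<Phi> \<mu> + fenchel_conj \<Phi> \<nu> - ereal (\<mu> \<bullet> \<nu>)"

text \<open>Real-valued versions, for use only where the extended value is finite.\<close>

definition fenchel_conj_real :: "('a::real_inner \<Rightarrow> ereal) \<Rightarrow> 'a \<Rightarrow> real" where
  "fenchel_conj_real \<Phi> \<nu> = real_of_ereal (fenchel_conj \<Phi> \<nu>)"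

definition fy_loss_real :: "('a::real_inner \<Rightarrow> ereal) \<Rightarrow> 'a \<Rightarrow> 'a \<Rightarrow> real" where
  "fy_loss_real \<Phi> \<mu> \<nu> = real_of_ereal (fy_loss \<Phi> \<mu> \<nu>)"

definition gradient :: "('a::real_inner \<Rightarrow> real) \<Rightarrow> 'a \<Rightarrow> 'a" where
  "gradient F x = (THE D. GDERIV F x :> D)"

lemma gradient_eq:
  assumes "GDERIV F x :> D"
  shows "gradient F x = D"
  unfolding gradient_def
proof (rule the_equality)
  show "GDERIV F x :> D" by (rule assms)
next
  fix E assume "GDERIV F x :> E"
  with assms have "(\<lambda>h. h \<bullet> E) = (\<lambda>h. h \<bullet> D)"
    unfolding gderiv_def by (rule has_derivative_unique[rotated])
  then have "(E - D) \<bullet> E = (E - D) \<bullet> D" by metis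
  then have "(E - D) \<bullet> (E - D) = 0" by (simp add: inner_diff_right)
  then show "E = D" by simp
qed

text \<open>\<open>\<H>(\<psi>)\<close>-convexity for functions whose domain is the whole space.\<close>

definition H_convex :: "('a::real_inner \<Rightarrow> real) \<Rightarrow> ('a \<Rightarrow> real) \<Rightarrow> bool" where
  "H_convex \<psi> F \<longleftrightarrow>
     (\<forall>\<nu>. F differentiable (at \<nu>)) \<and>
     (\<forall>\<mu> \<nu>. F \<mu> - F \<nu> - gradient F \<nu> \<bullet> (\<mu> - \<nu>) \<ge> \<psi> (\<mu> - \<nu>))"

definition l2_power :: "real \<Rightarrow> real \<Rightarrow> 'a::real_inner \<Rightarrow> real" where
  "l2_power a r \<mu> = norm (a *\<^sub>R \<mu>) powr r / r"

text \<open>Here \<open>r'\<close> is the exponent conjugate to \<open>r\<close>; \<open>fenchel_conj_l2_power\<close> shows that this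
  is the conjugate of \<open>l2_power a r\<close> on every inner product space.\<close>

definition l2_power_conj :: "real \<Rightarrow> real \<Rightarrow> 'a::real_inner \<Rightarrow> real" where
  "l2_power_conj a r' \<nu> = norm (\<nu> /\<^sub>R a) powr r' / r'"

lemma fenchel_conj_l2_power:
  fixes \<nu> :: "'a::real_inner"
  assumes a: "a > 0" and r: "r > 1" and rr': "1 / r + 1 / r' = 1"
  shows "fenchel_conj (\<lambda>\<mu>. ereal (l2_power a r \<mu>)) \<nu> = ereal (l2_power_conj a r' \<nu>)"
proof -
  have r'_eq: "1 / r' = (r - 1) / r" using rr' r by (simp add: field_simps)
  then have r'_eq2: "r' = r / (r - 1)" using r by (metis inverse_divide inverse_eq_divide inverse_inverse_eq)
  have r'1: "r' > 1" using r by (simp add: r'_eq2)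
  have le: "\<mu> \<bullet> \<nu> - l2_power a r \<mu> \<le> l2_power_conj a r' \<nu>" for \<mu>
  proof -
    have "\<mu> \<bullet> \<nu> = (a *\<^sub>R \<mu>) \<bullet> (\<nu> /\<^sub>R a)" using a by simp
    also have "\<dots> \<le> norm (a *\<^sub>R \<mu>) * norm (\<nu> /\<^sub>R a)" by (rule norm_cauchy_schwarz)
    also have "\<dots> \<le> norm (a *\<^sub>R \<mu>) powr r / r + norm (\<nu> /\<^sub>R a) powr r' / r'"
      using r r'1 rr' by (intro Youngs_inequality) auto
    finally show ?thesis by (simp add: l2_power_def l2_power_conj_def)
  qed
  have ex: "\<exists>\<mu>. \<mu> \<bullet> \<nu> - l2_power a r \<mu> = l2_power_conj a r' \<nu>"
  proof (cases "\<nu> = 0")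
    case True
    then show ?thesis
      by (intro exI[of _ 0]) (simp add: l2_power_def l2_power_conj_def)
  next
    case False
    define w where "w = \<nu> /\<^sub>R a"
    define n where "n = norm w"
    have n: "n > 0" using False a by (simp add: n_def w_def)
    define \<mu> where "\<mu> = (n powr (r' - 2) / a) *\<^sub>R w"
    have \<nu>: "\<nu> = a *\<^sub>R w" using a by (simp add: w_def)
    have "\<mu> \<bullet> \<nu> = n powr (r' - 2) * n\<^sup>2"
      using a by (simp add: \<mu>_def \<nu> n_def power2_norm_eq_inner)
    also have "\<dots> = n powr r'"
      using n by (simp add: powr_diff)
    finally have 1: "\<mu> \<bullet> \<nu> = n powr r'" .
    have "norm (a *\<^sub>R \<mu>) = n powr (r' - 2) * n"
      using a by (simp add: \<mu>_def n_def)
    also have "\<dots> = n powr (r' - 1)"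
      using n by (simp add: powr_diff power2_eq_square)
    finally have "norm (a *\<^sub>R \<mu>) powr r = n powr ((r' - 1) * r)"
      by (simp add: powr_powr)
    also have "(r' - 1) * r = r'" using r by (simp add: r'_eq2 field_simps)
    finally have 2: "l2_power a r \<mu> = n powr r' / r" by (simp add: l2_power_def)
    have "n powr r' - n powr r' / r = n powr r' * (1 - 1 / r)" by (simp add: algebra_simps)
    also have "1 - 1 / r = 1 / r'" using rr' by simp
    finally show ?thesis
      by (intro exI[of _ \<mu>]) (simp add: 1 2 l2_power_conj_def n_def w_def)
  qed
  then obtain \<mu> where \<mu>: "\<mu> \<bullet> \<nu> - l2_power a r \<mu> = l2_power_conj a r' \<nu>" by blast
  show ?thesis
    unfolding fenchel_conj_def
    by (intro antisym SUP_least SUP_upper2[of \<mu>]) (use le \<mu> in auto)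
qed

definition one_hot :: "'y::finite \<Rightarrow> real^'y" where
  "one_hot y = axis y 1"

text \<open>The \<open>p \<times> m\<close> matrix whose column \<open>j\<close> is the gradient of the \<open>j\<close>-th output.\<close>

definition grad_matrix :: "(real^'p \<Rightarrow> real^'m) \<Rightarrow> real^'p \<Rightarrow> real^'m^'p" where
  "grad_matrix F \<theta> = (\<chi> i j. gradient (\<lambda>t. F t $ j) \<theta> $ i)"

definition structure_matrix :: "(real^'p \<Rightarrow> real^'m) \<Rightarrow> real^'p \<Rightarrow> real^'m^'m" where
  "structure_matrix F \<theta> = transpose (grad_matrix F \<theta>) ** grad_matrix F \<theta>"

definition eigenvalues :: "real^'m^'m \<Rightarrow> real set" where
  "eigenvalues A = {l. \<exists>v. v \<noteq> 0 \<and> A *v v = l *\<^sub>R v}"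

text \<open>Only meant for symmetric matrices, whose set of real eigenvalues is nonempty
  (and finite, as for every matrix).\<close>

definition lambda_min :: "real^'m^'m \<Rightarrow> real" where
  "lambda_min A = Min (eigenvalues A)"

definition lambda_max :: "real^'m^'m \<Rightarrow> real" where
  "lambda_max A = Max (eigenvalues A)"

text \<open>A dataset is a list of samples, so repeated samples count with multiplicity.\<close>

definition empirical_pmf :: "('x \<times> 'y) list \<Rightarrow> ('x \<times> 'y) pmf" where
  "empirical_pmf s = pmf_of_multiset (mset s)"

definition fy_risk ::
    "(real^'y \<Rightarrow> ereal) \<Rightarrow> ('x \<times> 'y::finite) pmf \<Rightarrow> ('x \<Rightarrow> real^'y) \<Rightarrow> real" where
  "fy_risk \<Phi> q h = measure_pmf.expectation q (\<lambda>(x, y). fy_loss_real \<Phi> (one_hot y) (h x))"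

definition l2_risk :: "('x \<times> 'y::finite) pmf \<Rightarrow> ('x \<Rightarrow> real^'y) \<Rightarrow> real" where
  "l2_risk q h = measure_pmf.expectation q (\<lambda>(x, y). 1 / 2 * (norm (one_hot y - h x))\<^sup>2)"

definition dual_pred :: "(real^'y \<Rightarrow> ereal) \<Rightarrow> ('x \<Rightarrow> real^'y) \<Rightarrow> 'x \<Rightarrow> real^'y" where
  "dual_pred \<Phi> h x = gradient (fenchel_conj_real \<Phi>) (h x)"

definition loss_grad ::
    "(real^'y \<Rightarrow> ereal) \<Rightarrow> (real^'p \<Rightarrow> 'x \<Rightarrow> real^'y::finite) \<Rightarrow> real^'p \<Rightarrow> 'x \<Rightarrow> 'y \<Rightarrow> real^'p" where
  "loss_grad \<Phi> f \<theta> x y = gradient (\<lambda>t. fy_loss_real \<Phi> (one_hot y) (f t x)) \<theta>"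

end

theory Submission
  imports Defs
begin

text \<open>
  By the chain rule \<open>g(x,y) = G (\<nabla>\<Phi>\<^sup>*(f x) - 1\<^sub>y)\<close> with \<open>G\<close> the gradient matrix, so that
  \<open>\<parallel>g\<parallel>\<^sup>2\<close> is the quadratic form of \<open>A\<^sub>x = G\<^sup>T G\<close> and the individual bounds are Rayleigh quotient
  estimates. For the Fenchel-Young risk, minimising the lower bound given by \<open>\<H>(\<psi>)\<close>-convexity
  over the first argument shows that \<open>F = d\<^sub>\<Phi>(1\<^sub>y, \<cdot>)\<close> exceeds its infimum by at most
  \<open>\<psi>\<^sup>*(\<nabla>F)\<close>, and this infimum is \<open>0\<close> by Fenchel-Moreau duality at \<open>1\<^sub>y\<close>.
\<close>

section \<open>Extreme eigenvalues of symmetric matrices and Rayleigh bounds\<close>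

lemma symmetric_matrix_inner:
  fixes A :: "real^'n^'n"
  assumes "transpose A = A"
  shows "v \<bullet> (A *v w) = (A *v v) \<bullet> w"
  by (metis assms dot_lmul_matrix transpose_matrix_vector)

text \<open>A nonnegative quadratic form that vanishes at \<open>v\<close> has a minimum there. A
  short step from \<open>v\<close> against \<open>u = B *v v\<close> would make it negative unless
  \<open>u = 0\<close>.\<close>

lemma psd_null_vector:
  fixes B :: "real^'n^'n"
  assumes sym: "transpose B = B"
    and psd: "\<And>w. 0 \<le> w \<bullet> (B *v w)"
    and v: "v \<bullet> (B *v v) = 0"
  shows "B *v v = 0"
proof -
  define u where "u = B *v v"
  define c where "c = u \<bullet> (B *v u)"
  have c: "c \<ge> 0" using psd by (simp add: c_def)
  \<comment> \<open>The quadratic in \<open>t\<close> below is least at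
    \<open>- (u \<bullet> u) / c\<close>; the denominator \<open>c + 1\<close> still makes it
    negative for \<open>u \<noteq> 0\<close> and also covers \<open>c = 0\<close>.\<close>
  define t where "t = - (u \<bullet> u) / (c + 1)"
  have "(v + t *\<^sub>R u) \<bullet> (B *v (v + t *\<^sub>R u)) = 2 * t * (u \<bullet> u) + t\<^sup>2 * c"
    using v symmetric_matrix_inner[OF sym, of v u]
    by (simp add: matrix_vector_right_distrib matrix_vector_mult_scaleR inner_add_left
        inner_add_right u_def[symmetric] c_def power2_eq_square algebra_simps)
  with psd[of "v + t *\<^sub>R u"] have "0 \<le> 2 * t * (u \<bullet> u) + t\<^sup>2 * c" by simp
  then have "0 \<le> (2 * t * (u \<bullet> u) + t\<^sup>2 * c) * (c + 1)\<^sup>2" by simp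
  also have "\<dots> = 2 * (t * (c + 1)) * (u \<bullet> u) * (c + 1) + (t * (c + 1))\<^sup>2 * c"
    by (simp add: power2_eq_square algebra_simps)
  also have "t * (c + 1) = - (u \<bullet> u)" using c by (simp add: t_def)
  finally have "(u \<bullet> u)\<^sup>2 * (c + 2) \<le> 0" by (simp add: power2_eq_square algebra_simps)
  then have "(u \<bullet> u)\<^sup>2 \<le> 0" using c by (simp add: mult_le_0_iff)
  then show ?thesis by (simp add: u_def)
qed

text \<open>The form attains a minimum \<open>l\<close> on the compact unit sphere, and homogeneity
  extends the bound to all \<open>w\<close>. Then \<open>A - l *\<^sub>R mat 1\<close> is positive
  semidefinite and its form vanishes at the minimiser, which is therefore an eigenvector for
  \<open>l\<close>.\<close>

lemma symmetric_min_eigenvalue: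
  fixes A :: "real^'n^'n"
  assumes sym: "transpose A = A"
  obtains l where "l \<in> eigenvalues A" "\<And>w. l * (norm w)\<^sup>2 \<le> w \<bullet> (A *v w)"
proof -
  have "compact (sphere (0::real^'n) 1)" by simp
  moreover have "axis undefined 1 \<in> sphere (0::real^'n) 1" by simp
  then have "sphere (0::real^'n) 1 \<noteq> {}" by blast
  moreover have "continuous_on (sphere 0 1) (\<lambda>v. v \<bullet> (A *v v))"
    by (intro continuous_intros)
  ultimately obtain v where v: "v \<in> sphere 0 1"
    and min: "\<And>w. w \<in> sphere 0 1 \<Longrightarrow> v \<bullet> (A *v v) \<le> w \<bullet> (A *v w)"
    using continuous_attains_inf by metis
  define l where "l = v \<bullet> (A *v v)"
  have le: "l * (norm w)\<^sup>2 \<le> w \<bullet> (A *v w)" for w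
  proof (cases "w = 0")
    case False
    have "l \<le> (w /\<^sub>R norm w) \<bullet> (A *v (w /\<^sub>R norm w))"
      unfolding l_def using False by (intro min) simp
    also have "\<dots> = (w \<bullet> (A *v w)) / (norm w)\<^sup>2"
      by (simp add: matrix_vector_mult_scaleR power2_eq_square divide_inverse mult_ac)
    finally show ?thesis using False by (simp add: pos_le_divide_eq)
  qed simp
  define B where "B = A - l *\<^sub>R mat 1"
  have B: "B *v w = A *v w - l *\<^sub>R w" for w
    by (simp add: B_def matrix_vector_mult_diff_rdistrib scaleR_matrix_vector_assoc[symmetric])
  have "B *v v = 0"
  proof (rule psd_null_vector)
    show "transpose B = B"
      using sym by (simp add: B_def transpose_def vec_eq_iff mat_def)
    show "0 \<le> w \<bullet> (B *v w)" for w
      using le[of w] by (simp add: B inner_diff_right dot_square_norm)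
    show "v \<bullet> (B *v v) = 0"
      using v by (simp add: B inner_diff_right dot_square_norm l_def)
  qed
  then have "l \<in> eigenvalues A"
    using v by (auto simp: B eigenvalues_def intro!: exI[of _ v])
  then show ?thesis using le that by blast
qed

text \<open>Eigenvectors for distinct eigenvalues are orthogonal, hence independent, so there are
  finitely many. This gives \<open>Min\<close> and \<open>Max\<close> in \<open>lambda_min\<close>
  and \<open>lambda_max\<close> their intended meaning.\<close>

lemma finite_eigenvalues_symmetric:
  fixes A :: "real^'n^'n"
  assumes sym: "transpose A = A"
  shows "finite (eigenvalues A)"
proof -
  have "\<forall>l\<in>eigenvalues A. \<exists>v. v \<noteq> 0 \<and> A *v v = l *\<^sub>R v"
    by (auto simp: eigenvalues_def)
  then obtain e where e: "\<And>l. l \<in> eigenvalues A \<Longrightarrow> e l \<noteq> 0 \<and> A *v e l = l *\<^sub>R e l"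
    by metis
  have inj: "inj_on e (eigenvalues A)"
    by (rule inj_onI) (metis e scaleR_cancel_right)
  have orth: "e l \<bullet> e k = 0" if "l \<in> eigenvalues A" "k \<in> eigenvalues A" "l \<noteq> k" for l k
  proof -
    have "k * (e l \<bullet> e k) = l * (e l \<bullet> e k)"
      using symmetric_matrix_inner[OF sym, of "e l" "e k"] e[OF that(1)] e[OF that(2)] by simp
    then show ?thesis using that(3) by simp
  qed
  have "pairwise orthogonal (e ` eigenvalues A)"
    unfolding pairwise_def orthogonal_def using orth by blast
  moreover have "0 \<notin> e ` eigenvalues A" using e by force
  ultimately have "finite (e ` eigenvalues A)"
    using pairwise_orthogonal_independent independent_imp_finite by blast
  then show ?thesis using inj by (simp add: finite_image_iff)
qed

lemma lambda_min_le_quadratic_form: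
  assumes "transpose A = A"
  shows "lambda_min A * (norm w)\<^sup>2 \<le> w \<bullet> (A *v w)"
proof -
  obtain l where l: "l \<in> eigenvalues A" "\<And>w. l * (norm w)\<^sup>2 \<le> w \<bullet> (A *v w)"
    using symmetric_min_eigenvalue[OF assms] by blast
  have "lambda_min A \<le> l"
    unfolding lambda_min_def using l finite_eigenvalues_symmetric[OF assms] by simp
  then have "lambda_min A * (norm w)\<^sup>2 \<le> l * (norm w)\<^sup>2" by (simp add: mult_right_mono)
  then show ?thesis using l(2)[of w] by linarith
qed

text \<open>This is the minimum principle applied to \<open>- A\<close>, whose eigenvalues are the
  negatives of those of \<open>A\<close>.\<close>

lemma quadratic_form_le_lambda_max:
  assumes sym: "transpose A = A"
  shows "w \<bullet> (A *v w) \<le> lambda_max A * (norm w)\<^sup>2"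
proof -
  have neg: "(- A) *v v = - (A *v v)" for v
    by (simp add: matrix_vector_mult_def vec_eq_iff sum_negf)
  have "transpose (- A) = - A" using sym by (simp add: transpose_def vec_eq_iff)
  then obtain l where l: "l \<in> eigenvalues (- A)" "\<And>w. l * (norm w)\<^sup>2 \<le> w \<bullet> ((- A) *v w)"
    using symmetric_min_eigenvalue by blast
  from l(1) obtain v where "v \<noteq> 0" "- (A *v v) = l *\<^sub>R v" by (auto simp: eigenvalues_def neg)
  then have "v \<noteq> 0 \<and> A *v v = (- l) *\<^sub>R v" by (metis add.inverse_inverse scaleR_minus_left)
  then have "- l \<in> eigenvalues A" unfolding eigenvalues_def by blast
  then have "- l \<le> lambda_max A"
    unfolding lambda_max_def using finite_eigenvalues_symmetric[OF sym] by simp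
  then have "- l * (norm w)\<^sup>2 \<le> lambda_max A * (norm w)\<^sup>2" by (intro mult_right_mono) auto
  then show ?thesis using l(2)[of w] by (simp add: neg)
qed

lemma lambda_min_mem_eigenvalues:
  assumes "transpose A = A"
  shows "lambda_min A \<in> eigenvalues A"
  unfolding lambda_min_def
  using symmetric_min_eigenvalue[OF assms] finite_eigenvalues_symmetric[OF assms]
  by (metis Min_in empty_iff)

lemma lambda_min_le_lambda_max:
  assumes "transpose A = A"
  shows "lambda_min A \<le> lambda_max A"
  using lambda_min_mem_eigenvalues[OF assms] finite_eigenvalues_symmetric[OF assms]
  by (simp add: lambda_max_def)

section \<open>The structure matrix as a Gram matrix\<close>

lemma transpose_structure_matrix: "transpose (structure_matrix F \<theta>) = structure_matrix F \<theta>"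
  by (simp add: structure_matrix_def matrix_transpose_mul)

lemma structure_matrix_quadratic_form:
  "w \<bullet> (structure_matrix F \<theta> *v w) = (norm (grad_matrix F \<theta> *v w))\<^sup>2"
  by (simp add: structure_matrix_def matrix_vector_mul_assoc[symmetric] dot_square_norm[symmetric]
      dot_lmul_matrix[symmetric] inner_commute)

text \<open>At an eigenvector \<open>v\<close> the form equals both
  \<open>lambda_min ?A * (v \<bullet> v)\<close> and a squared norm. This later turns
  \<open>lam_s \<noteq> 0\<close> into positivity.\<close>

lemma lambda_min_structure_matrix_nonneg: "0 \<le> lambda_min (structure_matrix F \<theta>)"
proof -
  let ?A = "structure_matrix F \<theta>"
  obtain v where v: "v \<noteq> 0" "?A *v v = lambda_min ?A *\<^sub>R v"
    using lambda_min_mem_eigenvalues[OF transpose_structure_matrix, of F \<theta>]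
    by (auto simp: eigenvalues_def)
  then have "lambda_min ?A * (v \<bullet> v) = (norm (grad_matrix F \<theta> *v v))\<^sup>2"
    using structure_matrix_quadratic_form[of v F \<theta>] by simp
  then show ?thesis using v(1)
    by (metis inner_gt_zero_iff not_less zero_le_power2 mult_neg_pos)
qed

section \<open>Gradients and the chain rule\<close>

lemma differentiable_imp_GDERIV:
  fixes F :: "'a::euclidean_space \<Rightarrow> real"
  assumes "F differentiable (at x)"
  shows "GDERIV F x :> gradient F x"
proof -
  obtain F' where F': "(F has_derivative F') (at x)" using assms by (auto simp: differentiable_def)
  then have "linear F'" by (rule has_derivative_linear)
  \<comment> \<open>Riesz representation: the adjoint at \<open>1\<close> supplies the vector that
    the definite description in \<open>gradient\<close> picks out.\<close>
  then have "F' = (\<lambda>h. h \<bullet> adjoint F' 1)" by (simp add: adjoint_works)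
  with F' have "GDERIV F x :> adjoint F' 1" by (simp add: gderiv_def)
  with gradient_eq[OF this] show ?thesis by simp
qed

text \<open>The gradients of the outputs are the columns, so \<open>grad_matrix\<close> is the
  transposed Jacobian and the derivative multiplies it by a row vector from the left.\<close>

lemma has_derivative_grad_matrix:
  assumes "F differentiable (at \<theta>)"
  shows "(F has_derivative (\<lambda>h. h v* grad_matrix F \<theta>)) (at \<theta>)"
proof -
  obtain J where J: "(F has_derivative J) (at \<theta>)" using assms by (auto simp: differentiable_def)
  have "J h $ j = (h v* grad_matrix F \<theta>) $ j" for h j
  proof -
    have comp: "((\<lambda>t. F t $ j) has_derivative (\<lambda>h. J h $ j)) (at \<theta>)"
      by (rule bounded_linear.has_derivative[OF bounded_linear_vec_nth J])
    then have "GDERIV (\<lambda>t. F t $ j) \<theta> :> gradient (\<lambda>t. F t $ j) \<theta>"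
      by (intro differentiable_imp_GDERIV) (auto simp: differentiable_def)
    then have "(\<lambda>h. J h $ j) = (\<lambda>h. h \<bullet> gradient (\<lambda>t. F t $ j) \<theta>)"
      unfolding gderiv_def using comp has_derivative_unique by blast
    then have "J h $ j = h \<bullet> gradient (\<lambda>t. F t $ j) \<theta>" by metis
    then show ?thesis
      by (simp add: vector_matrix_mult_def grad_matrix_def inner_vec_def mult.commute)
  qed
  then have "J = (\<lambda>h. h v* grad_matrix F \<theta>)" by (auto simp: vec_eq_iff)
  with J show ?thesis by simp
qed

lemma GDERIV_compose_grad_matrix:
  assumes "F differentiable (at \<theta>)" and "GDERIV L (F \<theta>) :> e"
  shows "GDERIV (\<lambda>t. L (F t)) \<theta> :> grad_matrix F \<theta> *v e"
  using has_derivative_compose[OF has_derivative_grad_matrix[OF assms(1)]] assms(2)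
  unfolding gderiv_def by (fastforce simp: dot_lmul_matrix)

section \<open>The Fenchel-Young loss: gradient, infimum and gradient bound\<close>

lemma fy_loss_real_eq:
  assumes "proper_fun \<Phi>" "\<mu> \<in> eff_dom \<Phi>" "\<bar>fenchel_conj \<Phi> \<nu>\<bar> \<noteq> \<infinity>"
  shows "fy_loss_real \<Phi> \<mu> \<nu> = real_of_ereal (\<Phi> \<mu>) + fenchel_conj_real \<Phi> \<nu> - \<mu> \<bullet> \<nu>"
proof -
  obtain p where p: "\<Phi> \<mu> = ereal p"
    using assms by (cases "\<Phi> \<mu>") (auto simp: proper_fun_def eff_dom_def)
  obtain c where c: "fenchel_conj \<Phi> \<nu> = ereal c"
    using assms(3) by (cases "fenchel_conj \<Phi> \<nu>") auto
  show ?thesis by (simp add: fy_loss_real_def fy_loss_def fenchel_conj_real_def p c)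
qed

text \<open>In its second argument the loss is the conjugate plus an affine function with slope
  \<open>- \<mu>\<close>.\<close>

lemma GDERIV_fy_loss_real:
  fixes \<Phi> :: "'a::euclidean_space \<Rightarrow> ereal"
  assumes "proper_fun \<Phi>" "\<mu> \<in> eff_dom \<Phi>" "\<And>\<nu>. \<bar>fenchel_conj \<Phi> \<nu>\<bar> \<noteq> \<infinity>"
    and "fenchel_conj_real \<Phi> differentiable (at \<nu>)"
  shows "GDERIV (fy_loss_real \<Phi> \<mu>) \<nu> :> gradient (fenchel_conj_real \<Phi>) \<nu> - \<mu>"
proof -
  have "GDERIV (\<lambda>\<nu>. \<mu> \<bullet> \<nu>) \<nu> :> \<mu>"
    unfolding gderiv_def by (auto intro!: derivative_eq_intros simp: inner_commute)
  moreover have "GDERIV (fenchel_conj_real \<Phi>) \<nu> :> gradient (fenchel_conj_real \<Phi>) \<nu>"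
    using assms(4) by (rule differentiable_imp_GDERIV)
  ultimately have "GDERIV (\<lambda>\<nu>. real_of_ereal (\<Phi> \<mu>) + fenchel_conj_real \<Phi> \<nu> - \<mu> \<bullet> \<nu>) \<nu>
      :> 0 + gradient (fenchel_conj_real \<Phi>) \<nu> - \<mu>"
    by (intro GDERIV_diff GDERIV_add GDERIV_const)
  moreover have "fy_loss_real \<Phi> \<mu> = (\<lambda>\<nu>. real_of_ereal (\<Phi> \<mu>) + fenchel_conj_real \<Phi> \<nu> - \<mu> \<bullet> \<nu>)"
    using fy_loss_real_eq[OF assms(1-3)] by blast
  ultimately show ?thesis by simp
qed

lemma convex_epigraph:
  fixes \<Phi> :: "'a::real_vector \<Rightarrow> ereal"
  assumes proper: "proper_fun \<Phi>" and strict: "strictly_convex_fun \<Phi>"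
  shows "convex {(x, t::real). \<Phi> x \<le> ereal t}"
  unfolding convex_alt
proof (clarsimp)
  fix x s y t and u :: real
  assume xs: "\<Phi> x \<le> ereal s" and yt: "\<Phi> y \<le> ereal t" and u: "0 \<le> u" "u \<le> 1"
  obtain p where p: "\<Phi> x = ereal p" using xs proper by (cases "\<Phi> x") (auto simp: proper_fun_def)
  obtain q where q: "\<Phi> y = ereal q" using yt proper by (cases "\<Phi> y") (auto simp: proper_fun_def)
  have le: "(1 - u) * p + u * q \<le> (1 - u) * s + u * t"
    using xs yt p q u by (intro add_mono mult_left_mono) auto
  \<comment> \<open>Strict convexity speaks only of distinct points and weights strictly between 0
    and 1; the degenerate cases are immediate.\<close>
  consider "u = 0" | "u = 1" | "x = y" | "x \<noteq> y" "0 < u" "u < 1" using u by linarith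
  then show "\<Phi> ((1 - u) *\<^sub>R x + u *\<^sub>R y) \<le> ereal ((1 - u) * s + u * t)"
  proof cases
    case 3
    then have "(1 - u) *\<^sub>R x + u *\<^sub>R y = x" by (simp add: scaleR_left_distrib[symmetric])
    moreover have "(1 - u) * p + u * q = p" using 3 p q by (simp add: algebra_simps)
    ultimately show ?thesis using le p by simp
  next
    case 4
    have "\<Phi> ((1 - u) *\<^sub>R x + u *\<^sub>R y) < ereal (1 - u) * \<Phi> x + ereal u * \<Phi> y"
      using strict[unfolded strictly_convex_fun_def, rule_format, of x y u] 4 p q
      by (simp add: eff_dom_def)
    also have "\<dots> = ereal ((1 - u) * p + u * q)" by (simp add: p q)
    also have "\<dots> \<le> ereal ((1 - u) * s + u * t)" using le by simp
    finally show ?thesis by simp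
  qed (use xs yt in auto)
qed

text \<open>The inequality \<open>\<Phi>\<^sup>*\<^sup>* \<ge> \<Phi>\<close> of Fenchel-Moreau duality. At a point of the effective domain
  the separating hyperplane is not vertical, so no further argument is needed.\<close>

lemma fy_loss_real_arbitrarily_small:
  fixes \<Phi> :: "'a::euclidean_space \<Rightarrow> ereal"
  assumes closed: "closed_fun \<Phi>" and proper: "proper_fun \<Phi>" and strict: "strictly_convex_fun \<Phi>"
    and \<mu>: "\<mu> \<in> eff_dom \<Phi>" and fin: "\<And>\<nu>. \<bar>fenchel_conj \<Phi> \<nu>\<bar> \<noteq> \<infinity>" and "\<epsilon> > 0"
  obtains \<nu> where "fy_loss_real \<Phi> \<mu> \<nu> < \<epsilon>"
proof -
  obtain p where p: "\<Phi> \<mu> = ereal p"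
    using \<mu> proper by (cases "\<Phi> \<mu>") (auto simp: proper_fun_def eff_dom_def)
  let ?E = "{(x, t::real). \<Phi> x \<le> ereal t}"
  have "(\<mu>, p - \<epsilon>) \<notin> ?E" using p \<open>\<epsilon> > 0\<close> by simp
  then obtain n b where n: "n \<bullet> (\<mu>, p - \<epsilon>) < b" "\<And>z. z \<in> ?E \<Longrightarrow> b < n \<bullet> z"
    using separating_hyperplane_closed_point[of ?E "(\<mu>, p - \<epsilon>)"] closed
      convex_epigraph[OF proper strict] unfolding closed_fun_def by blast
  obtain \<alpha> \<beta> where \<alpha>\<beta>: "n = (\<alpha>, \<beta>)" by (cases n)
  have lo: "\<alpha> \<bullet> \<mu> + \<beta> * (p - \<epsilon>) < b" using n(1) by (simp add: \<alpha>\<beta>)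
  have up: "b < \<alpha> \<bullet> x + \<beta> * t" if "\<Phi> x \<le> ereal t" for x t
    using n(2)[of "(x, t)"] that by (simp add: \<alpha>\<beta>)
  have "\<beta> * \<epsilon> > 0" using lo up[of \<mu> p] p by (simp add: algebra_simps)
  then have \<beta>: "\<beta> > 0" using \<open>\<epsilon> > 0\<close> by (simp add: zero_less_mult_iff)
  \<comment> \<open>Solved for the last coordinate, the hyperplane is the graph of
    \<open>x \<bullet> \<nu> + b / \<beta>\<close>. This affine function minorises
    \<open>\<Phi>\<close>, which bounds the conjugate at \<open>\<nu>\<close> by
    \<open>- b / \<beta>\<close>, and at \<open>\<mu>\<close> it exceeds
    \<open>p - \<epsilon>\<close>.\<close>
  define \<nu> where "\<nu> = - (\<alpha> /\<^sub>R \<beta>)"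
  have inner_\<nu>: "\<beta> * (x \<bullet> \<nu>) = - (\<alpha> \<bullet> x)" for x using \<beta> by (simp add: \<nu>_def inner_commute)
  have "fenchel_conj \<Phi> \<nu> \<le> ereal (- b / \<beta>)"
    unfolding fenchel_conj_def
  proof (rule SUP_least)
    fix x
    show "ereal (x \<bullet> \<nu>) - \<Phi> x \<le> ereal (- b / \<beta>)"
    proof (cases "\<Phi> x")
      case (real t)
      have "b < \<alpha> \<bullet> x + \<beta> * t" using up[of x t] real by simp
      then have "\<beta> * (x \<bullet> \<nu> - t) \<le> - b" by (simp add: right_diff_distrib inner_\<nu>)
      then show ?thesis using \<beta> real by (simp add: field_simps)
    next
      case MInf
      then show ?thesis using proper by (simp add: proper_fun_def)
    qed simp
  qed
  then have "fenchel_conj_real \<Phi> \<nu> \<le> - b / \<beta>"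
    using fin[of \<nu>] by (cases "fenchel_conj \<Phi> \<nu>") (auto simp: fenchel_conj_real_def)
  then have "\<beta> * fenchel_conj_real \<Phi> \<nu> \<le> - b" using \<beta> by (simp add: field_simps)
  then have "\<beta> * (p + fenchel_conj_real \<Phi> \<nu> - \<mu> \<bullet> \<nu>) < \<beta> * \<epsilon>"
    using lo by (simp add: algebra_simps inner_\<nu>)
  then have "fy_loss_real \<Phi> \<mu> \<nu> < \<epsilon>"
    using \<beta> by (simp add: fy_loss_real_eq[OF proper \<mu> fin] p)
  then show ?thesis by (rule that)
qed

text \<open>Solving the convexity inequality for \<open>F \<nu>\<close> leaves a linear term in
  \<open>\<mu> - \<nu>\<close> minus the power function at \<open>\<mu> - \<nu>\<close>, which the
  conjugate at \<open>- gradient F \<nu>\<close> dominates. The sign drops out because the conjugate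
  depends only on the norm. The bound is uniform in \<open>\<mu>\<close>.\<close>

lemma H_convex_l2_power_upper:
  fixes F :: "'a::real_inner \<Rightarrow> real"
  assumes H: "H_convex (l2_power a r) F" and a: "a > 0" and r: "r > 1" "1 / r + 1 / r' = 1"
  shows "F \<nu> \<le> F \<mu> + l2_power_conj a r' (gradient F \<nu>)"
proof -
  have "F \<mu> - F \<nu> - gradient F \<nu> \<bullet> (\<mu> - \<nu>) \<ge> l2_power a r (\<mu> - \<nu>)"
    using H by (simp add: H_convex_def)
  moreover have "ereal ((\<mu> - \<nu>) \<bullet> - gradient F \<nu>) - ereal (l2_power a r (\<mu> - \<nu>))
      \<le> fenchel_conj (\<lambda>\<mu>. ereal (l2_power a r \<mu>)) (- gradient F \<nu>)"
    unfolding fenchel_conj_def by (rule SUP_upper) simp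
  then have "(\<mu> - \<nu>) \<bullet> - gradient F \<nu> - l2_power a r (\<mu> - \<nu>) \<le> l2_power_conj a r' (- gradient F \<nu>)"
    by (simp add: fenchel_conj_l2_power[OF a r])
  moreover have "l2_power_conj a r' (- gradient F \<nu>) = l2_power_conj a r' (gradient F \<nu>)"
    by (simp add: l2_power_conj_def)
  ultimately show ?thesis by (simp add: inner_commute)
qed

text \<open>The previous bound is compared with points of loss below \<open>\<epsilon>\<close>, so
  no minimiser has to be produced.\<close>

lemma fy_loss_real_le_conj_gradient:
  fixes \<Phi> :: "'a::euclidean_space \<Rightarrow> ereal"
  assumes "closed_fun \<Phi>" "proper_fun \<Phi>" "strictly_convex_fun \<Phi>"
    and "\<mu> \<in> eff_dom \<Phi>" "\<And>\<nu>. \<bar>fenchel_conj \<Phi> \<nu>\<bar> \<noteq> \<infinity>"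
    and "H_convex (l2_power a r) (fy_loss_real \<Phi> \<mu>)" "a > 0" "r > 1" "1 / r + 1 / r' = 1"
  shows "fy_loss_real \<Phi> \<mu> \<nu> \<le> l2_power_conj a r' (gradient (fy_loss_real \<Phi> \<mu>) \<nu>)"
proof (rule field_le_epsilon)
  fix \<epsilon> :: real assume "\<epsilon> > 0"
  then obtain \<nu>' where "fy_loss_real \<Phi> \<mu> \<nu>' < \<epsilon>"
    using fy_loss_real_arbitrarily_small[OF assms(1-5)] by blast
  then show "fy_loss_real \<Phi> \<mu> \<nu> \<le> l2_power_conj a r' (gradient (fy_loss_real \<Phi> \<mu>) \<nu>) + \<epsilon>"
    using H_convex_l2_power_upper[OF assms(6-9), of \<nu> \<nu>'] by linarith
qed

text \<open>The conjugate is homogeneous of degree \<open>r'\<close> in the norm, so a factor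
  \<open>l\<close> between squared norms becomes \<open>l powr (r' / 2)\<close>. The vectors may
  live in different spaces, as the residual and the parameter gradient do.\<close>

lemma l2_power_conj_le_of_norm_le:
  fixes e :: "'a::real_inner" and g :: "'b::real_inner"
  assumes a: "a > 0" and r': "r' > 0" and l: "l > 0" and le: "l * (norm e)\<^sup>2 \<le> (norm g)\<^sup>2"
  shows "l2_power_conj a r' e \<le> l2_power_conj a r' g / l powr (r' / 2)"
proof -
  have "(sqrt l * norm e)\<^sup>2 \<le> (norm g)\<^sup>2" using l le by (simp add: power_mult_distrib)
  then have "sqrt l * norm e \<le> norm g" by (rule power2_le_imp_le) simp
  then have "sqrt l * norm (e /\<^sub>R a) \<le> norm (g /\<^sub>R a)" using a by (simp add: field_simps)
  then have "(sqrt l * norm (e /\<^sub>R a)) powr r' \<le> norm (g /\<^sub>R a) powr r'"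
    using r' l by (intro powr_mono2) auto
  moreover have "(sqrt l * norm (e /\<^sub>R a)) powr r' = l powr (r' / 2) * norm (e /\<^sub>R a) powr r'"
    using l by (simp add: powr_mult powr_half_sqrt[symmetric] powr_powr)
  ultimately have "norm (e /\<^sub>R a) powr r' \<le> norm (g /\<^sub>R a) powr r' / l powr (r' / 2)"
    using l by (simp add: pos_le_divide_eq mult.commute)
  then have "norm (e /\<^sub>R a) powr r' / r' \<le> norm (g /\<^sub>R a) powr r' / l powr (r' / 2) / r'"
    using r' by (intro divide_right_mono) auto
  then show ?thesis by (simp add: l2_power_conj_def mult.commute)
qed

lemma expectation_mono_pmf_finite:
  fixes u v :: "'a \<Rightarrow> real"
  assumes "finite (set_pmf q)" "\<And>z. z \<in> set_pmf q \<Longrightarrow> u z \<le> v z"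
  shows "measure_pmf.expectation q u \<le> measure_pmf.expectation q v"
  using assms by (intro integral_mono_AE integrable_measure_pmf_finite) (auto simp: AE_measure_pmf_iff)


theorem proposition5:
  fixes s :: "('x::finite \<times> 'y::finite) list"
    and f :: "real^'p \<Rightarrow> 'x \<Rightarrow> real^'y"
    and \<theta> :: "real^'p"
    and \<Phi> :: "real^'y \<Rightarrow> ereal"
    and a r r' :: real
  defines "A \<equiv> \<lambda>x. structure_matrix (\<lambda>t. f t x) \<theta>"
    and "g \<equiv> loss_grad \<Phi> f \<theta>"
    and "q \<equiv> empirical_pmf s"
    and "lam_s \<equiv> Min ((\<lambda>(x, y). lambda_min (structure_matrix (\<lambda>t. f t x) \<theta>)) ` set s)"
  assumes "s \<noteq> []"
    and "\<And>x t. (\<lambda>t. f t x) differentiable (at t)"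
    and "closed_fun \<Phi>" and "proper_fun \<Phi>" and "strictly_convex_fun \<Phi>"
    and "\<And>y. one_hot y \<in> eff_dom \<Phi>"
    and "\<And>\<nu>. \<bar>fenchel_conj \<Phi> \<nu>\<bar> \<noteq> \<infinity>"
    and "\<And>\<nu>. fenchel_conj_real \<Phi> differentiable (at \<nu>)"
    and "a > 0" and "r > 1" and "1 / r + 1 / r' = 1"
    and "\<And>y. H_convex (l2_power a r) (fy_loss_real \<Phi> (one_hot y))"
    and "lam_s \<noteq> 0"
  shows "(\<forall>(x, y) \<in> set s.
            (norm (g x y))\<^sup>2 / lambda_max (A x) \<le> (norm (one_hot y - dual_pred \<Phi> (f \<theta>) x))\<^sup>2 \<and>
            (norm (one_hot y - dual_pred \<Phi> (f \<theta>) x))\<^sup>2 \<le> (norm (g x y))\<^sup>2 / lambda_min (A x))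
       \<and> l2_risk q (dual_pred \<Phi> (f \<theta>))
           \<le> measure_pmf.expectation q (\<lambda>(x, y). (norm (g x y))\<^sup>2 / (2 * lambda_min (A x)))
       \<and> fy_risk \<Phi> q (f \<theta>)
           \<le> measure_pmf.expectation q (\<lambda>(x, y). l2_power_conj a r' (g x y)) / lam_s powr (r' / 2)"
proof -
  \<comment> \<open>The sign makes the residual \<open>e x y\<close> the gradient of the loss in the
    model output; the claim uses only its norm.\<close>
  define e where "e = (\<lambda>x y. dual_pred \<Phi> (f \<theta>) x - one_hot y)"
  have e_norm: "norm (one_hot y - dual_pred \<Phi> (f \<theta>) x) = norm (e x y)" for x y
    by (simp add: e_def norm_minus_commute)
  have grad_fy: "GDERIV (fy_loss_real \<Phi> (one_hot y)) (f \<theta> x) :> e x y" for x y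
    unfolding e_def dual_pred_def using assms by (intro GDERIV_fy_loss_real) auto
  have g_eq: "g x y = grad_matrix (\<lambda>t. f t x) \<theta> *v e x y" for x y
    unfolding g_def loss_grad_def
    by (rule gradient_eq, rule GDERIV_compose_grad_matrix)
      (use assms grad_fy in auto)
  have g_norm: "(norm (g x y))\<^sup>2 = e x y \<bullet> (A x *v e x y)" for x y
    unfolding A_def g_eq structure_matrix_quadratic_form ..
  have symA: "transpose (A x) = A x" for x unfolding A_def by (rule transpose_structure_matrix)
  have lower: "lambda_min (A x) * (norm (e x y))\<^sup>2 \<le> (norm (g x y))\<^sup>2" for x y
    unfolding g_norm by (rule lambda_min_le_quadratic_form[OF symA])
  have upper: "(norm (g x y))\<^sup>2 \<le> lambda_max (A x) * (norm (e x y))\<^sup>2" for x y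
    unfolding g_norm by (rule quadratic_form_le_lambda_max[OF symA])
  have set_q: "set_pmf q = set s" using \<open>s \<noteq> []\<close> by (simp add: q_def empirical_pmf_def)
  have fin: "finite (set_pmf q)" by (simp add: set_q)
  have lam_le: "lam_s \<le> lambda_min (A x)" if "(x, y) \<in> set s" for x y
    unfolding lam_s_def A_def using that by (intro Min_le) force+
  have "lam_s \<in> (\<lambda>(x, y). lambda_min (structure_matrix (\<lambda>t. f t x) \<theta>)) ` set s"
    unfolding lam_s_def using \<open>s \<noteq> []\<close> by (intro Min_in) auto
  \<comment> \<open>The minimum is attained at some sample, where it is a nonnegative
    eigenvalue.\<close>
  then have lam_pos: "lam_s > 0"
    using lambda_min_structure_matrix_nonneg \<open>lam_s \<noteq> 0\<close> by (force simp: less_le)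
  have min_pos: "lambda_min (A x) > 0" if "(x, y) \<in> set s" for x y
    using lam_le[OF that] lam_pos by linarith
  \<comment> \<open>Positivity makes both quotients genuine, since division by zero would yield
    0.\<close>
  have max_pos: "lambda_max (A x) > 0" if "(x, y) \<in> set s" for x y
    using min_pos[OF that] lambda_min_le_lambda_max[OF symA, of x] by linarith
  have sample1: "(norm (g x y))\<^sup>2 / lambda_max (A x) \<le> (norm (e x y))\<^sup>2"
    and sample2: "(norm (e x y))\<^sup>2 \<le> (norm (g x y))\<^sup>2 / lambda_min (A x)"
    if "(x, y) \<in> set s" for x y
    using upper[of x y] lower[of x y] max_pos[OF that] min_pos[OF that]
    by (simp_all add: pos_divide_le_eq pos_le_divide_eq mult.commute)
  \<comment> \<open>From \<open>r > 1\<close> the reciprocal of \<open>r'\<close> is positive;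
    monotonicity of \<open>powr\<close> relies on this.\<close>
  have r': "r' > 0"
  proof -
    have "1 / r' > 0" using \<open>r > 1\<close> \<open>1 / r + 1 / r' = 1\<close>
      by (smt (verit) divide_less_eq_1_pos)
    then show ?thesis by simp
  qed
  have loss: "fy_loss_real \<Phi> (one_hot y) (f \<theta> x) \<le> l2_power_conj a r' (g x y) / lam_s powr (r' / 2)"
    if "(x, y) \<in> set s" for x y
  proof -
    \<comment> \<open>Duality first bounds the loss by the residual in output space; the eigenvalue
      bound then passes to \<open>g x y\<close> in parameter space, with the uniform constant
      \<open>lam_s\<close> in place of \<open>lambda_min (A x)\<close>.\<close>
    have "fy_loss_real \<Phi> (one_hot y) (f \<theta> x) \<le> l2_power_conj a r' (e x y)"
      using fy_loss_real_le_conj_gradient[of \<Phi> "one_hot y" a r r' "f \<theta> x"]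
        gradient_eq[OF grad_fy] assms by simp
    also have "\<dots> \<le> l2_power_conj a r' (g x y) / lam_s powr (r' / 2)"
    proof (rule l2_power_conj_le_of_norm_le[OF \<open>a > 0\<close> r' lam_pos])
      have "lam_s * (norm (e x y))\<^sup>2 \<le> lambda_min (A x) * (norm (e x y))\<^sup>2"
        by (rule mult_right_mono[OF lam_le[OF that]]) simp
      with lower[of x y] show "lam_s * (norm (e x y))\<^sup>2 \<le> (norm (g x y))\<^sup>2" by linarith
    qed
    finally show ?thesis .
  qed
  have "l2_risk q (dual_pred \<Phi> (f \<theta>))
      \<le> measure_pmf.expectation q (\<lambda>(x, y). (norm (g x y))\<^sup>2 / (2 * lambda_min (A x)))"
    unfolding l2_risk_def e_norm
    using sample2 by (intro expectation_mono_pmf_finite[OF fin]) (fastforce simp: set_q)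
  moreover have "fy_risk \<Phi> q (f \<theta>)
      \<le> measure_pmf.expectation q (\<lambda>(x, y). l2_power_conj a r' (g x y) / lam_s powr (r' / 2))"
    unfolding fy_risk_def
    using loss by (intro expectation_mono_pmf_finite[OF fin]) (auto simp: set_q)
  \<comment> \<open>The denominator is the same for every sample, so it leaves the
    expectation.\<close>
  then have "fy_risk \<Phi> q (f \<theta>)
      \<le> measure_pmf.expectation q (\<lambda>(x, y). l2_power_conj a r' (g x y)) / lam_s powr (r' / 2)"
    by (simp add: case_prod_unfold)
  ultimately show ?thesis using sample1 sample2 unfolding e_norm by blast
qed

end
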